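(* Let $m,n$ be positive integers and $U=\{1,2,\dots,m+n\}$. For a finite set $Z=\{z_1<z_2<\dots<z_k\}$ of integers (listed in increasing order) let $V_Z=\prod_{1\le i<j\le k}(z_j-z_i)$ (the empty product being $1$). For a positive integer $k$ let $G(k+1)=\prod_{j=1}^{k-1} j!=(k-1)!\,(k-2)!\cdots 1!$. Let $t$ be an integer with $\frac{m(m+1)}{2}\le t\le \frac{m(m+1)}{2}+mn$, and put $t^*=t-\frac{m(m+1)}{2}$. Then $$\sum_{\substack{X\subset U,\ |X|=m\\ \sum_{x\in X} x=t}} V_X\,V_{U\setminus X} \;=\; G(m+1)\,G(n+1)\binom{mn}{t^*},$$ where the sum runs over all $m$-element subsets $X$ of $U$ whose elements sum to $t$.
   Context: $G$ is the Barnes $G$-function evaluated at positive integers, i.e. $G(k+1)=(k-1)!\cdots 1!$. $V_Z$ denotes the Vandermonde product of the set $Z$ with its elements listed in increasing order. *)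

theory Defs
  imports Complex_Main
begin

definition vandermonde :: "int set \<Rightarrow> int" where
  "vandermonde Z =
     (let z = sorted_list_of_set Z
      in \<Prod>(i, j) | i < j \<and> j < card Z. z ! j - z ! i)"

(* The Barnes G-function at positive integers: barnes_G (k + 1) = (k - 1)! (k - 2)! ... 1!.
   The value barnes_G 0 = 1 is a by-product (the Barnes function vanishes at 0). *)
definition barnes_G :: "nat \<Rightarrow> nat" where
  "barnes_G k = (\<Prod>j\<in>{1..<k - 1}. fact j)"

end

theory Submission
  imports Defs "Jordan_Normal_Form.Determinant"
begin

text \<open>
  Put \<open>N = m + n\<close> and \<open>W x = (x - 1)! (N - x)!\<close>, the product of the distances from \<open>x\<close> to the other
  points of \<open>U = {1..N}\<close>. Then \<open>V\<^sub>X V\<^sub>U\<^sub>-\<^sub>X = V\<^sub>U V\<^sub>X\<^sup>2 / (\<Prod>x\<in>X. W x)\<close>, so the generating function in \<open>q\<close>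
  of the sums is, up to a constant, the partition function of the Krawtchouk ensemble with weight
  \<open>q\<^sup>x / W x\<close>. Writing \<open>V\<^sub>X\<close> once in the basis \<open>(x - 1) (x - 2) \<dots> (x - j)\<close> and once, up to sign, in the
  basis \<open>(N - x) (N - x - 1) \<dots> (N - x - j + 1)\<close>, Andreief's identity turns this into a determinant
  whose \<open>(i, j)\<close> entry is \<open>q\<^sup>i\<^sup>+\<^sup>1 (1 + q)\<^sup>M\<^sup>-\<^sup>i\<^sup>-\<^sup>j / (M - i - j)!\<close> with \<open>M = N - 1\<close> (0 if
  \<open>i + j > M\<close>). After pulling factors out of rows and columns, this is again a Vandermonde determinant, in the second basis at \<open>1, \<dots>, m\<close>.
  The theorem follows by comparing coefficients of \<open>q\<close>.
\<close>

section \<open>Determinants of polynomial values\<close>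

text \<open>Subtracting the top coefficient times the monic product \<open>N\<close> lowers the
  degree, so induction applies. The nodes may coincide, which matters because
  \<open>andreief\<close> also sums over tuples with repeated entries.\<close>

lemma newton_expansion:
  fixes p :: "'a::idom poly"
  assumes "degree p \<le> j"
  shows "\<exists>c. c j = coeff p j \<and> (\<forall>y. poly p y = (\<Sum>l\<le>j. c l * (\<Prod>k<l. y - x k)))"
  using assms
proof (induction j arbitrary: p)
  case 0
  then obtain a where "p = [:a:]"
    by (metis degree_eq_zeroE le_zero_eq)
  then show ?case
    by (intro exI[of _ "\<lambda>_. a"]) auto
next
  case (Suc j)
  define N where "N = (\<Prod>k<Suc j. [:- x k, 1:])"
  have dN: "degree N = Suc j"
    unfolding N_def by (subst degree_prod_eq_sum_degree) auto
  have "lead_coeff N = 1"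
    unfolding N_def by (subst lead_coeff_prod) auto
  then have cN: "coeff N (Suc j) = 1"
    using dN by simp
  define p' where "p' = p - smult (coeff p (Suc j)) N"
  have "degree p' \<le> j"
  proof (rule degree_le, intro allI impI)
    fix i assume "i > j"
    then consider "i = Suc j" | "i > Suc j"
      by linarith
    then show "coeff p' i = 0"
      using Suc.prems dN cN by cases (auto simp: p'_def coeff_eq_0)
  qed
  from Suc.IH[OF this] obtain c where
    c: "\<And>y. poly p' y = (\<Sum>l\<le>j. c l * (\<Prod>k<l. y - x k))"
    by blast
  have "poly p y = (\<Sum>l\<le>Suc j. (c(Suc j := coeff p (Suc j))) l * (\<Prod>k<l. y - x k))" for y
  proof -
    have "poly p y = poly p' y + coeff p (Suc j) * poly N y"
      by (simp add: p'_def)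
    also have "poly N y = (\<Prod>k<Suc j. y - x k)"
      by (simp add: N_def poly_prod del: prod.lessThan_Suc)
    finally show ?thesis
      unfolding c by (simp del: prod.lessThan_Suc)
  qed
  then show ?case
    by (intro exI[of _ "c(Suc j := coeff p (Suc j))"]) auto
qed

text \<open>Expanding each \<open>p j\<close> in the Newton basis at the nodes \<open>x\<close>
  themselves factors the matrix as \<open>N * T\<close>. Here \<open>N\<close> is lower triangular,
  since its entries with \<open>l > i\<close> contain the factor \<open>x i - x i\<close>, and
  \<open>T\<close> is upper triangular by the degree bound. The two diagonals give the two
  products.\<close>

lemma det_polys_eq_vandermonde:
  fixes p :: "nat \<Rightarrow> 'a::idom poly" and x :: "nat \<Rightarrow> 'a"
  assumes deg: "\<And>j. degree (p j) \<le> j"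
  shows "det (mat m m (\<lambda>(i, j). poly (p j) (x i)))
       = (\<Prod>j<m. coeff (p j) j) * (\<Prod>j<m. \<Prod>i<j. x j - x i)"
proof -
  obtain c where c1: "\<And>j. c j j = coeff (p j) j"
    and c2: "\<And>j y. poly (p j) y = (\<Sum>l\<le>j. c j l * (\<Prod>k<l. y - x k))"
    using newton_expansion[OF deg, of _ x] by metis
  define N where "N = mat m m (\<lambda>(i, l). \<Prod>k<l. x i - x k)"
  define T where "T = mat m m (\<lambda>(l, j). if l \<le> j then c j l else 0)"
  have carr: "N \<in> carrier_mat m m" "T \<in> carrier_mat m m"
    by (auto simp: N_def T_def)
  have "mat m m (\<lambda>(i, j). poly (p j) (x i)) = N * T"
  proof (rule eq_matI)
    fix i j assume "i < dim_row (N * T)" "j < dim_col (N * T)"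
    then have ij: "i < m" "j < m"
      using carr by auto
    have "(N * T) $$ (i, j) = (\<Sum>l<m. (\<Prod>k<l. x i - x k) * (if l \<le> j then c j l else 0))"
      using ij by (simp add: N_def T_def scalar_prod_def atLeast0LessThan)
    also have "\<dots> = (\<Sum>l\<le>j. (\<Prod>k<l. x i - x k) * (if l \<le> j then c j l else 0))"
      by (rule sum.mono_neutral_right) (use ij in auto)
    also have "\<dots> = poly (p j) (x i)"
      unfolding c2 by (intro sum.cong) auto
    finally show "mat m m (\<lambda>(i, j). poly (p j) (x i)) $$ (i, j) = (N * T) $$ (i, j)"
      using ij by simp
  qed (use carr in auto)
  then have "det (mat m m (\<lambda>(i, j). poly (p j) (x i))) = det N * det T"
    using det_mult[OF carr] by simp
  also have "det N = prod_list (diag_mat N)"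
    by (rule det_lower_triangular[OF _ carr(1)]) (auto simp: N_def)
  also have "\<dots> = (\<Prod>j<m. \<Prod>i<j. x j - x i)"
    by (simp add: prod_list_diag_prod N_def atLeast0LessThan)
  also have "det T = prod_list (diag_mat T)"
    by (rule det_upper_triangular[OF _ carr(2)]) (auto simp: T_def)
  also have "\<dots> = (\<Prod>j<m. coeff (p j) j)"
    by (simp add: prod_list_diag_prod T_def atLeast0LessThan c1)
  finally show ?thesis
    by (simp add: mult.commute)
qed

section \<open>Andreief's identity and sums over subsets\<close>

text \<open>Expanding both determinants over permutations \<sigma> and \<tau> splits the sum over
  tuples into a product of one-point sums, the entries of \<open>B\<close>. For fixed \<sigma>, the
  sum over \<tau> is the determinant of \<open>B\<close> with permuted rows, so the two signs of
  \<sigma> cancel and \<open>fact m\<close> equal terms remain.\<close>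

lemma andreief:
  fixes w :: "'b \<Rightarrow> 'a::comm_ring_1" and p r :: "nat \<Rightarrow> 'b \<Rightarrow> 'a"
  assumes "finite A"
  shows "(\<Sum>x\<in>{0..<m} \<rightarrow>\<^sub>E A. (\<Prod>i<m. w (x i)) * det (mat m m (\<lambda>(i, j). p j (x i)))
            * det (mat m m (\<lambda>(i, j). r j (x i))))
       = of_nat (fact m) * det (mat m m (\<lambda>(i, j). \<Sum>a\<in>A. w a * p i a * r j a))"
proof -
  define B where "B = mat m m (\<lambda>(i, j). \<Sum>a\<in>A. w a * p i a * r j a)"
  have B: "B \<in> carrier_mat m m"
    by (simp add: B_def)
  let ?P = "{\<sigma>. \<sigma> permutes {0..<m}}"
  let ?F = "{0..<m} \<rightarrow>\<^sub>E A"
  have fP: "finite ?P"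
    by (simp add: finite_permutations)
  have inner: "(\<Sum>x\<in>?F. \<Prod>i=0..<m. w (x i) * p (\<sigma> i) (x i) * r (\<tau> i) (x i))
      = (\<Prod>i=0..<m. B $$ (\<sigma> i, \<tau> i))" if "\<sigma> \<in> ?P" "\<tau> \<in> ?P" for \<sigma> \<tau>
  proof -
    have "(\<Prod>i=0..<m. B $$ (\<sigma> i, \<tau> i)) = (\<Prod>i=0..<m. \<Sum>a\<in>A. w a * p (\<sigma> i) a * r (\<tau> i) a)"
      by (intro prod.cong)
        (use that permutes_in_image[of \<sigma> "{0..<m}"] permutes_in_image[of \<tau> "{0..<m}"] in \<open>auto simp: B_def\<close>)
    also have "\<dots> = (\<Sum>x\<in>?F. \<Prod>i=0..<m. w (x i) * p (\<sigma> i) (x i) * r (\<tau> i) (x i))"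
      by (subst prod_sum_PiE) (use assms in auto)
    finally show ?thesis ..
  qed
  have "(\<Sum>x\<in>?F. (\<Prod>i<m. w (x i)) * det (mat m m (\<lambda>(i, j). p j (x i)))
            * det (mat m m (\<lambda>(i, j). r j (x i))))
     = (\<Sum>x\<in>?F. (\<Prod>i=0..<m. w (x i)) * (\<Sum>\<sigma>\<in>?P. signof \<sigma> * (\<Prod>i=0..<m. p (\<sigma> i) (x i)))
            * (\<Sum>\<tau>\<in>?P. signof \<tau> * (\<Prod>i=0..<m. r (\<tau> i) (x i))))"
  proof (intro sum.cong refl)
    fix x
    have *: "det (mat m m (\<lambda>(i, j). f j (x i))) = (\<Sum>\<sigma>\<in>?P. signof \<sigma> * (\<Prod>i=0..<m. f (\<sigma> i) (x i)))"
      for f :: "nat \<Rightarrow> 'b \<Rightarrow> 'a"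
    proof -
      have "(\<Prod>i=0..<m. mat m m (\<lambda>(i, j). f j (x i)) $$ (i, \<sigma> i)) = (\<Prod>i=0..<m. f (\<sigma> i) (x i))"
        if "\<sigma> \<in> ?P" for \<sigma>
        by (intro prod.cong) (use that permutes_in_image[of \<sigma> "{0..<m}"] in auto)
      then show ?thesis
        by (subst det_def'[of _ m]) auto
    qed
    show "(\<Prod>i<m. w (x i)) * det (mat m m (\<lambda>(i, j). p j (x i)))
            * det (mat m m (\<lambda>(i, j). r j (x i))) = 
        (\<Prod>i=0..<m. w (x i)) * (\<Sum>\<sigma>\<in>?P. signof \<sigma> * (\<Prod>i=0..<m. p (\<sigma> i) (x i)))
            * (\<Sum>\<tau>\<in>?P. signof \<tau> * (\<Prod>i=0..<m. r (\<tau> i) (x i)))"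
      unfolding * by (simp add: atLeast0LessThan)
  qed
  also have "\<dots> = (\<Sum>x\<in>?F. \<Sum>\<sigma>\<in>?P. \<Sum>\<tau>\<in>?P. signof \<sigma> * (signof \<tau> *
       (\<Prod>i=0..<m. w (x i) * p (\<sigma> i) (x i) * r (\<tau> i) (x i))))"
    by (simp add: sum_distrib_left sum_distrib_right prod.distrib mult_ac)
  also have "\<dots> = (\<Sum>\<sigma>\<in>?P. \<Sum>\<tau>\<in>?P. \<Sum>x\<in>?F. signof \<sigma> * (signof \<tau> *
       (\<Prod>i=0..<m. w (x i) * p (\<sigma> i) (x i) * r (\<tau> i) (x i))))"
    by (subst sum.swap) (intro sum.cong refl sum.swap)
  also have "\<dots> = (\<Sum>\<sigma>\<in>?P. signof \<sigma> * (\<Sum>\<tau>\<in>?P. signof \<tau> * (\<Prod>i=0..<m. B $$ (\<sigma> i, \<tau> i))))"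
    unfolding sum_distrib_left
    by (intro sum.cong refl) (simp only: inner flip: sum_distrib_left)
  also have "\<dots> = (\<Sum>\<sigma>\<in>?P. det B)"
  proof (intro sum.cong refl)
    fix \<sigma> assume s: "\<sigma> \<in> ?P"
    have "(\<Prod>i=0..<m. mat m m (\<lambda>(i, j). B $$ (\<sigma> i, j)) $$ (i, \<tau> i)) = (\<Prod>i=0..<m. B $$ (\<sigma> i, \<tau> i))"
      if "\<tau> \<in> ?P" for \<tau>
      by (intro prod.cong) (use that permutes_in_image[of \<tau> "{0..<m}"] in auto)
    then have "(\<Sum>\<tau>\<in>?P. signof \<tau> * (\<Prod>i=0..<m. B $$ (\<sigma> i, \<tau> i)))
        = det (mat m m (\<lambda>(i, j). B $$ (\<sigma> i, j)))"
      by (subst det_def'[of _ m]) auto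
    also have "\<dots> = signof \<sigma> * det B"
      using det_permute_rows[OF B] s by simp
    finally show "signof \<sigma> * (\<Sum>\<tau>\<in>?P. signof \<tau> * (\<Prod>i=0..<m. B $$ (\<sigma> i, \<tau> i))) = det B"
      by (simp add: sign_def)
  qed
  also have "\<dots> = of_nat (fact m) * det B"
    by (simp add: card_permutations[of _ m])
  finally show ?thesis
    by (simp add: B_def)
qed

text \<open>As the cardinalities agree, these injections are bijections onto \<open>X\<close>, so
  composing a fixed bijection \<open>e\<close> with the permutations of the index set produces each
  of them once.\<close>

lemma card_inj_PiE:
  assumes "card X = m" "finite X"
  shows "card {f \<in> {0..<m} \<rightarrow>\<^sub>E X. inj_on f {0..<m}} = fact m"
proof -
  let ?I = "{0..<m}"
  obtain e where e: "bij_betw e ?I X"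
    using ex_bij_betw_nat_finite[OF assms(2)] assms(1) by blast
  let ?d = "inv_into ?I e"
  have d: "bij_betw ?d X ?I"
    using e by (rule bij_betw_inv_into)
  have "bij_betw (\<lambda>\<sigma>. restrict (e \<circ> \<sigma>) ?I) {\<sigma>. \<sigma> permutes ?I} {f \<in> ?I \<rightarrow>\<^sub>E X. inj_on f ?I}"
  \<comment> \<open>The inverse map continues \<open>?d\<close> after \<open>f\<close> by the
    identity off \<open>?I\<close>, because \<open>permutes\<close> requires all other points to be
    fixed.\<close>
  proof (rule bij_betwI[where g = "\<lambda>f i. if i \<in> ?I then ?d (f i) else i"])
    show "(\<lambda>\<sigma>. restrict (e \<circ> \<sigma>) ?I) \<in> {\<sigma>. \<sigma> permutes ?I} \<rightarrow> {f \<in> ?I \<rightarrow>\<^sub>E X. inj_on f ?I}"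
    proof
      fix \<sigma> assume "\<sigma> \<in> {\<sigma>. \<sigma> permutes ?I}"
      then have "bij_betw (e \<circ> \<sigma>) ?I X"
        using e permutes_imp_bij bij_betw_trans by blast
      then show "restrict (e \<circ> \<sigma>) ?I \<in> {f \<in> ?I \<rightarrow>\<^sub>E X. inj_on f ?I}"
        by (auto simp: bij_betw_def inj_on_def)
    qed
    show "(\<lambda>f i. if i \<in> ?I then ?d (f i) else i) \<in> {f \<in> ?I \<rightarrow>\<^sub>E X. inj_on f ?I} \<rightarrow> {\<sigma>. \<sigma> permutes ?I}"
    proof
      fix f assume f: "f \<in> {f \<in> ?I \<rightarrow>\<^sub>E X. inj_on f ?I}"
      then have "f ` ?I = X"
        by (intro card_subset_eq) (use assms in \<open>auto simp: card_image\<close>)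
      then have "bij_betw f ?I X"
        using f by (simp add: bij_betw_def)
      then have "bij_betw (?d \<circ> f) ?I ?I"
        using d bij_betw_trans by blast
      then have "bij_betw (\<lambda>i. if i \<in> ?I then ?d (f i) else i) ?I ?I"
        by (rule bij_betw_cong[THEN iffD1, rotated]) auto
      then show "(\<lambda>i. if i \<in> ?I then ?d (f i) else i) \<in> {\<sigma>. \<sigma> permutes ?I}"
        by (auto intro!: bij_imp_permutes)
    qed
    show "(\<lambda>i. if i \<in> ?I then ?d (restrict (e \<circ> \<sigma>) ?I i) else i) = \<sigma>"
      if "\<sigma> \<in> {\<sigma>. \<sigma> permutes ?I}" for \<sigma>
    proof
      fix i
      show "(if i \<in> ?I then ?d (restrict (e \<circ> \<sigma>) ?I i) else i) = \<sigma> i"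
        using that permutes_in_image[of \<sigma> ?I i] permutes_not_in[of \<sigma> ?I i] e
          inv_into_f_f[of e ?I "\<sigma> i"]
        by (auto simp: bij_betw_def)
    qed
    show "restrict (e \<circ> (\<lambda>i. if i \<in> ?I then ?d (f i) else i)) ?I = f"
      if "f \<in> {f \<in> ?I \<rightarrow>\<^sub>E X. inj_on f ?I}" for f
    proof
      fix i
      show "restrict (e \<circ> (\<lambda>i. if i \<in> ?I then ?d (f i) else i)) ?I i = f i"
        using that e f_inv_into_f[of "f i" e ?I]
        by (cases "i \<in> ?I") (auto simp: bij_betw_def PiE_def extensional_def Pi_def)
    qed
  qed
  then have "card {\<sigma>. \<sigma> permutes ?I} = card {f \<in> ?I \<rightarrow>\<^sub>E X. inj_on f ?I}"
    by (rule bij_betw_same_card)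
  then show ?thesis
    by (simp add: card_permutations[of _ m])
qed

text \<open>Translates the tuples of \<open>andreief\<close> into subsets: grouped by image, every
  \<open>m\<close>-subset collects \<open>fact m\<close> tuples.\<close>

lemma sum_inj_PiE_image:
  fixes g :: "'b set \<Rightarrow> 'a::comm_semiring_1"
  assumes "finite A"
  shows "(\<Sum>x | x \<in> {0..<m} \<rightarrow>\<^sub>E A \<and> inj_on x {0..<m}. g (x ` {0..<m}))
       = of_nat (fact m) * (\<Sum>X | X \<subseteq> A \<and> card X = m. g X)"
proof -
  let ?S = "{x. x \<in> {0..<m} \<rightarrow>\<^sub>E A \<and> inj_on x {0..<m}}"
  let ?T = "{X. X \<subseteq> A \<and> card X = m}"
  have fin: "finite ?S" "finite ?T"
    using assms by (auto intro!: finite_subset[of ?S "{0..<m} \<rightarrow>\<^sub>E A"] finite_PiE)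
  have "(\<Sum>x\<in>?S. g (x ` {0..<m})) = (\<Sum>X\<in>?T. \<Sum>x | x \<in> ?S \<and> x ` {0..<m} = X. g (x ` {0..<m}))"
    by (rule sum.group[symmetric]) (use fin in \<open>auto simp: card_image\<close>)
  also have "\<dots> = (\<Sum>X\<in>?T. of_nat (fact m) * g X)"
  proof (intro sum.cong refl)
    fix X assume X: "X \<in> ?T"
    then have fX: "finite X"
      using assms finite_subset by auto
    have "{x. x \<in> ?S \<and> x ` {0..<m} = X} = {f \<in> {0..<m} \<rightarrow>\<^sub>E X. inj_on f {0..<m}}"
    proof (intro Set.set_eqI iffI)
      fix f assume f: "f \<in> {f \<in> {0..<m} \<rightarrow>\<^sub>E X. inj_on f {0..<m}}"
      then have "f ` {0..<m} = X"
        by (intro card_subset_eq) (use X fX in \<open>auto simp: card_image\<close>)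
      then show "f \<in> {x. x \<in> ?S \<and> x ` {0..<m} = X}"
        using f X by (auto simp: PiE_def Pi_def)
    qed (auto simp: PiE_def Pi_def)
    then have "card {x. x \<in> ?S \<and> x ` {0..<m} = X} = fact m"
      using card_inj_PiE[of X m] X fX by simp
    then show "(\<Sum>x | x \<in> ?S \<and> x ` {0..<m} = X. g (x ` {0..<m})) = of_nat (fact m) * g X"
      by simp
  qed
  finally show ?thesis
    by (simp add: sum_distrib_left)
qed

section \<open>Vandermonde products of a set and of its complement\<close>

text \<open>By symmetry the two copies of an unordered pair can be read as its two
  orderings.\<close>

lemma prod_symmetric_square:
  fixes f :: "nat \<Rightarrow> nat \<Rightarrow> 'a::comm_monoid_mult"
  assumes "\<And>i j. f i j = f j i"
  shows "(\<Prod>j<m. \<Prod>i<j. f i j) * (\<Prod>j<m. \<Prod>i<j. f i j) = (\<Prod>j<m. \<Prod>i\<in>{..<m} - {j}. f i j)"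
proof (induction m)
  case (Suc m)
  have "(\<Prod>i\<in>{..<Suc m} - {j}. f i j) = (\<Prod>i\<in>{..<m} - {j}. f i j) * f j m" if "j < m" for j
  proof -
    have "{..<Suc m} - {j} = insert m ({..<m} - {j})"
      using that by auto
    then show ?thesis
      using assms by (simp add: mult.commute)
  qed
  then have "(\<Prod>j<m. \<Prod>i\<in>{..<Suc m} - {j}. f i j)
      = (\<Prod>j<m. \<Prod>i\<in>{..<m} - {j}. f i j) * (\<Prod>j<m. f j m)"
    by (simp add: prod.distrib)
  moreover have "{..<Suc m} - {m} = {..<m}"
    by auto
  ultimately show ?case
    using Suc.IH by (simp add: mult_ac)
qed simp

text \<open>Squaring removes the signs and hence the dependence on the order of enumeration: only
  the set \<open>Z\<close> survives on the right.\<close>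

lemma prod_differences_square:
  fixes x :: "nat \<Rightarrow> int"
  assumes "inj_on x {..<m}" "Z = x ` {..<m}"
  shows "(\<Prod>j<m. \<Prod>i<j. x j - x i)\<^sup>2 = (\<Prod>b\<in>Z. \<Prod>a\<in>Z - {b}. \<bar>a - b\<bar>)"
proof -
  have "(\<Prod>j<m. \<Prod>i<j. x j - x i)\<^sup>2 = \<bar>\<Prod>j<m. \<Prod>i<j. x j - x i\<bar>\<^sup>2"
    by simp
  also have "\<dots> = (\<Prod>j<m. \<Prod>i<j. \<bar>x i - x j\<bar>)\<^sup>2"
    by (simp add: abs_prod abs_minus_commute)
  also have "\<dots> = (\<Prod>j<m. \<Prod>i\<in>{..<m} - {j}. \<bar>x i - x j\<bar>)"
    unfolding power2_eq_square by (rule prod_symmetric_square) simp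
  also have "\<dots> = (\<Prod>j<m. \<Prod>a\<in>Z - {x j}. \<bar>a - x j\<bar>)"
  proof (intro prod.cong refl)
    fix j assume j: "j \<in> {..<m}"
    then have "Z - {x j} = x ` ({..<m} - {j})"
      using assms by (auto simp: inj_on_def)
    moreover have "inj_on x ({..<m} - {j})"
      using assms(1) by (rule inj_on_subset) auto
    ultimately show "(\<Prod>i\<in>{..<m} - {j}. \<bar>x i - x j\<bar>) = (\<Prod>a\<in>Z - {x j}. \<bar>a - x j\<bar>)"
      by (simp add: prod.reindex)
  qed
  also have "\<dots> = (\<Prod>b\<in>Z. \<Prod>a\<in>Z - {b}. \<bar>a - b\<bar>)"
    using assms by (simp add: prod.reindex)
  finally show ?thesis .
qed

lemma vandermonde_eq_nested_prod:
  "vandermonde Z = (\<Prod>j<card Z. \<Prod>i<j. sorted_list_of_set Z ! j - sorted_list_of_set Z ! i)"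
proof -
  let ?z = "sorted_list_of_set Z"
  have "vandermonde Z = (\<Prod>(i, j)\<in>{(i, j). i < j \<and> j < card Z}. ?z ! j - ?z ! i)"
    unfolding vandermonde_def Let_def ..
  also have "\<dots> = (\<Prod>(j, i)\<in>(SIGMA j:{..<card Z}. {..<j}). ?z ! j - ?z ! i)"
    by (rule prod.reindex_bij_witness[of _ "\<lambda>(j, i). (i, j)" "\<lambda>(i, j). (j, i)"]) auto
  also have "\<dots> = (\<Prod>j<card Z. \<Prod>i<j. ?z ! j - ?z ! i)"
    by (rule prod.Sigma[symmetric]) auto
  finally show ?thesis .
qed

text \<open>Positivity allows a Vandermonde product to be recovered from its square.\<close>

lemma vandermonde_pos: "vandermonde Z > 0"
  unfolding vandermonde_eq_nested_prod
  by (intro prod_pos ballI)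
    (auto simp: strict_sorted_list_of_set intro!: sorted_wrt_nth_less[of "(<)"])

lemma vandermonde_square:
  assumes "finite Z"
  shows "(vandermonde Z)\<^sup>2 = (\<Prod>b\<in>Z. \<Prod>a\<in>Z - {b}. \<bar>a - b\<bar>)"
proof -
  let ?z = "sorted_list_of_set Z"
  have "inj_on ((!) ?z) {..<card Z}"
    using assms by (auto simp: inj_on_def nth_eq_iff_index_eq)
  moreover have "Z = (!) ?z ` {..<card Z}"
    using nth_image[of "card Z" ?z] assms by (simp add: atLeast0LessThan)
  ultimately show ?thesis
    unfolding vandermonde_eq_nested_prod by (rule prod_differences_square)
qed

text \<open>With \<open>C\<close> the product of all distances between \<open>X\<close> and its
  complement, the vertex product over \<open>X\<close> is
  \<open>(vandermonde X)\<^sup>2 * C\<close>, while \<open>vandermonde U\<close> is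
  \<open>vandermonde X * vandermonde (U - X) * C\<close>. Eliminating \<open>C\<close> gives the
  claim.\<close>

lemma vandermonde_complement:
  assumes "finite U" "X \<subseteq> U"
  shows "vandermonde X * vandermonde (U - X) * (\<Prod>x\<in>X. \<Prod>u\<in>U - {x}. \<bar>u - x\<bar>)
       = vandermonde U * (vandermonde X)\<^sup>2"
proof -
  let ?Y = "U - X"
  define C where "C = (\<Prod>x\<in>X. \<Prod>y\<in>?Y. \<bar>y - x\<bar>)"
  have fin: "finite X" "finite ?Y"
    using assms finite_subset by auto
  have C': "(\<Prod>y\<in>?Y. \<Prod>x\<in>X. \<bar>x - y\<bar>) = C"
    unfolding C_def by (subst prod.swap) (simp add: abs_minus_commute)
  have X: "(\<Prod>x\<in>X. \<Prod>u\<in>U - {x}. \<bar>u - x\<bar>) = (vandermonde X)\<^sup>2 * C"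
  proof -
    have "(\<Prod>u\<in>U - {x}. \<bar>u - x\<bar>) = (\<Prod>u\<in>X - {x}. \<bar>u - x\<bar>) * (\<Prod>u\<in>?Y. \<bar>u - x\<bar>)"
      if "x \<in> X" for x
    proof -
      have "U - {x} = (X - {x}) \<union> ?Y"
        using that assms by auto
      then show ?thesis
        using fin by (simp add: prod.union_disjoint Diff_Int_distrib2 disjoint_iff)
    qed
    then show ?thesis
      using fin by (simp add: prod.distrib vandermonde_square C_def)
  qed
  have Y: "(\<Prod>y\<in>?Y. \<Prod>u\<in>U - {y}. \<bar>u - y\<bar>) = (vandermonde ?Y)\<^sup>2 * C"
  proof -
    have "(\<Prod>u\<in>U - {y}. \<bar>u - y\<bar>) = (\<Prod>u\<in>?Y - {y}. \<bar>u - y\<bar>) * (\<Prod>u\<in>X. \<bar>u - y\<bar>)"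
      if "y \<in> ?Y" for y
    proof -
      have "U - {y} = (?Y - {y}) \<union> X"
        using that assms by auto
      moreover have "(?Y - {y}) \<inter> X = {}"
        by auto
      ultimately show ?thesis
        using fin by (simp add: prod.union_disjoint)
    qed
    then show ?thesis
      using fin by (simp add: prod.distrib vandermonde_square C')
  qed
  \<comment> \<open>Ordered pairs in \<open>U\<close> are split by whether their base point lies in
    \<open>X\<close> or in \<open>?Y\<close>; each cross distance occurs in both groups, so
    \<open>C\<close> appears twice and a square root can be taken.\<close>
  have "(vandermonde U)\<^sup>2 = (vandermonde X)\<^sup>2 * C * ((vandermonde ?Y)\<^sup>2 * C)"
    unfolding vandermonde_square[OF assms(1)] X[symmetric] Y[symmetric]
    using prod.subset_diff[OF assms(2,1)] by (simp add: mult.commute)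
  also have "\<dots> = (vandermonde X * vandermonde ?Y * C)\<^sup>2"
    by (simp add: power2_eq_square)
  finally have "vandermonde U = vandermonde X * vandermonde ?Y * C"
    by (rule power2_eq_imp_eq)
      (auto simp: C_def less_imp_le[OF vandermonde_pos] intro!: prod_nonneg mult_nonneg_nonneg)
  then show ?thesis
    by (simp add: X power2_eq_square)
qed


section \<open>Partition function of the Krawtchouk ensemble\<close>

lemma det_scale_rows_columns:
  fixes a b :: "nat \<Rightarrow> 'a::comm_ring_1"
  shows "det (mat m m (\<lambda>(i, j). a i * c i j * b j))
       = (\<Prod>i<m. a i) * (\<Prod>j<m. b j) * det (mat m m (\<lambda>(i, j). c i j))"
proof -
  let ?P = "{\<sigma>. \<sigma> permutes {0..<m}}"
  have "(\<Prod>i=0..<m. mat m m (\<lambda>(i, j). a i * c i j * b j) $$ (i, \<sigma> i))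
      = (\<Prod>i<m. a i) * (\<Prod>j<m. b j) * (\<Prod>i=0..<m. mat m m (\<lambda>(i, j). c i j) $$ (i, \<sigma> i))"
    if s: "\<sigma> \<in> ?P" for \<sigma>
  proof -
    have "(\<Prod>i=0..<m. mat m m (\<lambda>(i, j). a i * c i j * b j) $$ (i, \<sigma> i))
        = (\<Prod>i=0..<m. a i * mat m m (\<lambda>(i, j). c i j) $$ (i, \<sigma> i) * b (\<sigma> i))"
      by (intro prod.cong) (use s permutes_in_image[of \<sigma> "{0..<m}"] in auto)
    also have "(\<Prod>i=0..<m. b (\<sigma> i)) = (\<Prod>i=0..<m. b i)"
      using prod.permute[of \<sigma> "{0..<m}" b] s by (simp add: o_def)
    ultimately show ?thesis
      by (simp add: prod.distrib atLeast0LessThan mult_ac)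
  qed
  then have "det (mat m m (\<lambda>(i, j). a i * c i j * b j))
      = (\<Sum>\<sigma>\<in>?P. signof \<sigma> * ((\<Prod>i<m. a i) * (\<Prod>j<m. b j)
          * (\<Prod>i=0..<m. mat m m (\<lambda>(i, j). c i j) $$ (i, \<sigma> i))))"
    by (subst det_def'[of _ m]) auto
  also have "\<dots> = (\<Prod>i<m. a i) * (\<Prod>j<m. b j) * det (mat m m (\<lambda>(i, j). c i j))"
    by (subst det_def'[of _ m]) (auto simp: sum_distrib_left mult_ac)
  finally show ?thesis .
qed

text \<open>This is the falling factorial of \<open>k\<close> of length \<open>j\<close>; for
  \<open>j > k\<close> it contains the factor with \<open>l = k\<close>, which is 0.\<close>

lemma prod_falling_nat:
  "(\<Prod>l<j. real k - real l) = (if j \<le> k then fact k / fact (k - j) else 0)"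
proof (induction j)
  case (Suc j)
  show ?case
  proof (cases "Suc j \<le> k")
    case True
    then have "k - j = Suc (k - Suc j)"
      by simp
    then have "fact (k - j) = (real k - real j) * fact (k - Suc j)"
      using True by (simp add: of_nat_diff)
    moreover have "real k - real j \<noteq> 0"
      using True by simp
    ultimately show ?thesis
      using Suc.IH True by simp
  qed (use Suc.IH in \<open>auto simp: not_less_eq_eq le_Suc_eq\<close>)
qed simp

lemma sum_interval_shift:
  "(\<Sum>x\<in>{1..int (Suc M)}. f x) = (\<Sum>k\<le>M. f (int k + 1))"
  by (rule sum.reindex_bij_witness[of _ "\<lambda>k. int k + 1" "\<lambda>x. nat (x - 1)"]) auto

text \<open>Evaluates the weight denominator: the points left of \<open>k + 1\<close> lie at
  distances \<open>1, ..., k\<close>, those to the right at distances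
  \<open>1, ..., M - k\<close>.\<close>

lemma prod_distances_interval:
  assumes "k \<le> M"
  shows "(\<Prod>u\<in>{1..int (Suc M)} - {int k + 1}. \<bar>u - (int k + 1)\<bar>) = fact k * fact (M - k)"
proof -
  have fact_int: "(fact d :: int) = (\<Prod>l<d. int l + 1)" for d
    by (induction d) (auto simp: algebra_simps)
  have "{1..int (Suc M)} - {int k + 1} = {1..int k} \<union> {int k + 2..int (Suc M)}"
    using assms by auto
  then have "(\<Prod>u\<in>{1..int (Suc M)} - {int k + 1}. \<bar>u - (int k + 1)\<bar>)
      = (\<Prod>u\<in>{1..int k}. \<bar>u - (int k + 1)\<bar>) * (\<Prod>u\<in>{int k + 2..int (Suc M)}. \<bar>u - (int k + 1)\<bar>)"
    by (simp add: prod.union_disjoint)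
  also have "(\<Prod>u\<in>{1..int k}. \<bar>u - (int k + 1)\<bar>) = (\<Prod>l<k. int l + 1)"
    by (rule prod.reindex_bij_witness[of _ "\<lambda>l. int k - int l" "\<lambda>u. nat (int k - u)"]) auto
  also have "(\<Prod>u\<in>{int k + 2..int (Suc M)}. \<bar>u - (int k + 1)\<bar>) = (\<Prod>l<M - k. int l + 1)"
    by (rule prod.reindex_bij_witness[of _ "\<lambda>l. int k + 2 + int l" "\<lambda>u. nat (u - int k - 2)"])
      (use assms in auto)
  finally show ?thesis
    by (simp add: fact_int)
qed

lemma vandermonde_interval: "vandermonde {1..int N} = (\<Prod>k<N. fact k)"
proof -
  \<comment> \<open>Comparing squares permits any enumeration of the interval, so the sorted list
    need not be identified.\<close>
  define x where "x = (\<lambda>i. int i + 1)"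
  have "{1..int N} = x ` {..<N}"
  proof
    show "{1..int N} \<subseteq> x ` {..<N}"
    proof
      fix u assume "u \<in> {1..int N}"
      then show "u \<in> x ` {..<N}"
        by (intro image_eqI[of _ _ "nat (u - 1)"]) (auto simp: x_def)
    qed
  qed (auto simp: x_def)
  then have "(vandermonde {1..int N})\<^sup>2 = (\<Prod>j<N. \<Prod>i<j. x j - x i)\<^sup>2"
    using prod_differences_square[of x N] by (simp add: vandermonde_square x_def inj_on_def)
  moreover have "(\<Prod>i<j. x j - x i) = fact j" for j
  proof -
    have "(\<Prod>i<j. x j - x i) = (\<Prod>i<j. int (j - i))"
      by (intro prod.cong) (auto simp: x_def)
    also have "\<dots> = (\<Prod>i<j. int (Suc i))"
      by (rule prod.reindex_bij_witness[of _ "\<lambda>i. j - Suc i" "\<lambda>i. j - Suc i"]) auto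
    also have "\<dots> = fact j"
      by (induction j) (auto simp: algebra_simps)
    finally show ?thesis .
  qed
  ultimately have "(vandermonde {1..int N})\<^sup>2 = (\<Prod>j<N. fact j)\<^sup>2"
    by simp
  then show ?thesis
    by (rule power2_eq_imp_eq) (auto intro!: prod_nonneg less_imp_le[OF vandermonde_pos])
qed

text \<open>The falling factorials cancel against the factorials of the weight and leave a binomial
  sum. The right side is arranged as a row factor, a falling factorial coupling \<open>i\<close> and
  \<open>j\<close>, and a column factor, ready for \<open>det_scale_rows_columns\<close>. For
  \<open>i + j > M\<close> that falling factorial vanishes, as does every summand.\<close>

lemma krawtchouk_moment:
  fixes q :: real
  assumes "q > 0" "i \<le> M"
  shows "(\<Sum>k\<le>M. q ^ (k + 1) / (fact k * fact (M - k))
            * (\<Prod>l<i. real k - real l) * (\<Prod>l<j. real (M - k) - real l))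
       = q ^ (i + 1) * (1 + q) ^ (M - i) / fact (M - i) * (\<Prod>l<j. real (M - i) - real l) * (1 / (1 + q) ^ j)"
    (is "?L = ?R")
proof -
  \<comment> \<open>\<open>g k\<close> is the summand after cancellation; its zero branch covers the
    \<open>k\<close> at which a falling factorial contains 0.\<close>
  define g where "g = (\<lambda>k. if i \<le> k \<and> k + j \<le> M then q ^ (k + 1) / (fact (k - i) * fact (M - k - j)) else 0)"
  have "?L = (\<Sum>k\<le>M. g k)"
    by (intro sum.cong refl) (auto simp: prod_falling_nat g_def simp del: of_nat_diff)
  also have "\<dots> = ?R"
  proof (cases "i + j \<le> M")
    case False
    then have "g k = 0" for k
      by (auto simp: g_def)
    then show ?thesis
      using False assms by (simp add: prod_falling_nat del: of_nat_diff)
  next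
    case True
    define D where "D = M - i - j"
    have "(\<Sum>k\<le>M. g k) = (\<Sum>k\<in>{i..M - j}. g k)"
      by (rule sum.mono_neutral_right) (use True in \<open>auto simp: g_def\<close>)
    also have "\<dots> = (\<Sum>l\<le>D. q ^ (i + l + 1) / (fact l * fact (D - l)))"
      by (rule sum.reindex_bij_witness[of _ "\<lambda>l. i + l" "\<lambda>k. k - i"])
        (use True in \<open>auto simp: g_def D_def add.commute\<close>)
    also have "\<dots> = (\<Sum>l\<le>D. q ^ (i + 1) / fact D * (real (D choose l) * q ^ l * 1 ^ (D - l)))"
      by (intro sum.cong refl) (auto simp: binomial_fact power_add field_simps)
    also have "\<dots> = q ^ (i + 1) / fact D * (q + 1) ^ D"
      by (simp add: binomial_ring sum_distrib_left)
    \<comment> \<open>The falling factorial of \<open>M - i\<close> of length \<open>j\<close>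
      equals \<open>(M - i)! / D!\<close>, and \<open>(1 + q) ^ D\<close> is
      \<open>(1 + q) ^ (M - i)\<close> divided by \<open>(1 + q) ^ j\<close>.\<close>
    also have "\<dots> = ?R"
    proof -
      have "(1 + q) ^ (M - i) = (1 + q) ^ D * (1 + q) ^ j"
        using True by (simp add: D_def flip: power_add)
      then show ?thesis
        using True assms by (simp add: prod_falling_nat D_def add.commute del: of_nat_diff)
    qed
    finally show ?thesis .
  qed
  finally show ?thesis .
qed

lemma krawtchouk_ensemble:
  fixes q :: real
  assumes q: "q > 0" and m: "m \<le> Suc M" and U: "U = {1..int (Suc M)}"
  shows "(\<Sum>X | X \<subseteq> U \<and> card X = m.
            (\<Prod>x\<in>X. q ^ nat x / real_of_int (\<Prod>u\<in>U - {x}. \<bar>u - x\<bar>)) * (real_of_int (vandermonde X))\<^sup>2)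
       = (\<Prod>i<m. q ^ (i + 1) * (1 + q) ^ (M - i) / fact (M - i)) * (\<Prod>i<m. 1 / (1 + q) ^ i) * (\<Prod>i<m. fact i)"
proof -
  define w where "w x = q ^ nat x / real_of_int (\<Prod>u\<in>U - {x}. \<bar>u - x\<bar>)" for x
  \<comment> \<open>At the point \<open>k + 1\<close> the values of \<open>p j\<close> and
    \<open>r j\<close> are the falling factorials of \<open>k\<close> and of \<open>M - k\<close>,
    as in \<open>krawtchouk_moment\<close>. The leading coefficients of the \<open>r j\<close>
    multiply to the sign \<open>s\<close>.\<close>
  define p where "p j = (\<Prod>l<j. [:- (1 + real l), 1:])" for j
  define r where "r j = (\<Prod>l<j. [:real (Suc M) - real l, - 1:])" for j
  define s :: real where "s = (\<Prod>j<m. (- 1) ^ j)"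
  have deg: "degree (p j) = j" "degree (r j) = j" for j
    unfolding p_def r_def by (subst degree_prod_eq_sum_degree; auto)+
  have "lead_coeff (p j) = 1" "lead_coeff (r j) = (- 1) ^ j" for j
    unfolding p_def r_def by (subst lead_coeff_prod; simp)+
  then have lead: "coeff (p j) j = 1" "coeff (r j) j = (- 1) ^ j" for j
    using deg by metis+
  have poly_p: "poly (p j) y = (\<Prod>l<j. y - 1 - real l)" for j y
    by (simp add: p_def poly_prod algebra_simps)
  have poly_r: "poly (r j) y = (\<Prod>l<j. real (Suc M) - y - real l)" for j y
    by (simp add: r_def poly_prod algebra_simps)
  have fin: "finite U"
    by (simp add: U)
  have s2: "s * s = 1"
    by (simp add: s_def flip: prod.distrib power_add mult_2)
  \<comment> \<open>Each determinant is, up to sign, the product of differences of the tuple. A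
    repeated entry makes it 0; for an injective tuple the two together give \<open>s\<close> times
    the squared Vandermonde product of the image.\<close>
  have "(\<Sum>x\<in>{0..<m} \<rightarrow>\<^sub>E U. (\<Prod>i<m. w (x i)) * det (mat m m (\<lambda>(i, j). poly (p j) (real_of_int (x i))))
            * det (mat m m (\<lambda>(i, j). poly (r j) (real_of_int (x i)))))
    = (\<Sum>x | x \<in> {0..<m} \<rightarrow>\<^sub>E U \<and> inj_on x {0..<m}.
        s * ((\<Prod>a\<in>x ` {0..<m}. w a) * (real_of_int (vandermonde (x ` {0..<m})))\<^sup>2))"
  proof (rule sum.mono_neutral_cong_right)
    have dets: "det (mat m m (\<lambda>(i, j). poly (p j) (real_of_int (x i))))
            * det (mat m m (\<lambda>(i, j). poly (r j) (real_of_int (x i))))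
        = s * real_of_int ((\<Prod>j<m. \<Prod>i<j. x j - x i)\<^sup>2)" for x
      using det_polys_eq_vandermonde[of p m "\<lambda>i. real_of_int (x i)"]
        det_polys_eq_vandermonde[of r m "\<lambda>i. real_of_int (x i)"] deg
      by (simp add: lead s_def power2_eq_square)
    show "finite ({0..<m} \<rightarrow>\<^sub>E U)"
      using fin by (simp add: finite_PiE)
    show "(\<Prod>i<m. w (x i)) * det (mat m m (\<lambda>(i, j). poly (p j) (real_of_int (x i))))
            * det (mat m m (\<lambda>(i, j). poly (r j) (real_of_int (x i))))
        = s * ((\<Prod>a\<in>x ` {0..<m}. w a) * (real_of_int (vandermonde (x ` {0..<m})))\<^sup>2)"
      if "x \<in> {x. x \<in> {0..<m} \<rightarrow>\<^sub>E U \<and> inj_on x {0..<m}}" for x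
    proof -
      have inj: "inj_on x {..<m}"
        using that by (simp add: atLeast0LessThan)
      then have "(\<Prod>j<m. \<Prod>i<j. x j - x i)\<^sup>2 = (vandermonde (x ` {..<m}))\<^sup>2"
        by (simp add: prod_differences_square[OF _ refl] vandermonde_square)
      moreover have "(\<Prod>a\<in>x ` {..<m}. w a) = (\<Prod>i<m. w (x i))"
        using inj by (simp add: prod.reindex)
      ultimately show ?thesis
        using dets[of x] by (simp add: atLeast0LessThan mult.assoc)
    qed
    show "\<forall>x\<in>({0..<m} \<rightarrow>\<^sub>E U) - {x. x \<in> {0..<m} \<rightarrow>\<^sub>E U \<and> inj_on x {0..<m}}.
        (\<Prod>i<m. w (x i)) * det (mat m m (\<lambda>(i, j). poly (p j) (real_of_int (x i))))
            * det (mat m m (\<lambda>(i, j). poly (r j) (real_of_int (x i)))) = 0"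
    proof
      fix x assume "x \<in> ({0..<m} \<rightarrow>\<^sub>E U) - {x. x \<in> {0..<m} \<rightarrow>\<^sub>E U \<and> inj_on x {0..<m}}"
      then obtain i j where "i < m" "j < m" "i \<noteq> j" "x i = x j"
        by (auto simp: inj_on_def)
      then obtain i j where ij: "j < m" "i < j" "x i = x j"
        by (metis nat_neq_iff)
      then have "(\<Prod>i<j. x j - x i) = 0"
        by (intro prod_zero bexI[of _ i]) auto
      then have "(\<Prod>j<m. \<Prod>i<j. x j - x i) = 0"
        using ij(1) by (intro prod_zero) auto
      then show "(\<Prod>i<m. w (x i)) * det (mat m m (\<lambda>(i, j). poly (p j) (real_of_int (x i))))
            * det (mat m m (\<lambda>(i, j). poly (r j) (real_of_int (x i)))) = 0"
        using dets[of x] by (simp add: mult.assoc)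
    qed
  qed auto
  also have "\<dots> = s * (fact m * (\<Sum>X | X \<subseteq> U \<and> card X = m. (\<Prod>a\<in>X. w a) * (real_of_int (vandermonde X))\<^sup>2))"
    using sum_inj_PiE_image[OF fin, where m = m and g = "\<lambda>X. (\<Prod>a\<in>X. w a) * (real_of_int (vandermonde X))\<^sup>2"]
    by (simp flip: sum_distrib_left)
  finally have "s * (\<Sum>X | X \<subseteq> U \<and> card X = m. (\<Prod>a\<in>X. w a) * (real_of_int (vandermonde X))\<^sup>2)
     = det (mat m m (\<lambda>(i, j). \<Sum>a\<in>U. w a * poly (p i) (real_of_int a) * poly (r j) (real_of_int a)))"
    using andreief[OF fin, where m = m and w = w and p = "\<lambda>j a. poly (p j) (real_of_int a)"
        and r = "\<lambda>j a. poly (r j) (real_of_int a)"]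
    by simp
  also have "mat m m (\<lambda>(i, j). \<Sum>a\<in>U. w a * poly (p i) (real_of_int a) * poly (r j) (real_of_int a))
     = mat m m (\<lambda>(i, j). q ^ (i + 1) * (1 + q) ^ (M - i) / fact (M - i)
          * poly (r j) (real (i + 1)) * (1 / (1 + q) ^ j))"
  proof (rule cong_mat)
    fix i j assume "i < m" "j < m"
    then have iM: "i \<le> M"
      using m by simp
    have w: "w (int k + 1) = q ^ (k + 1) / (fact k * fact (M - k))" if "k \<le> M" for k
      using prod_distances_interval[OF that] by (simp add: w_def U nat_add_distrib)
    have "(\<Sum>a\<in>U. w a * poly (p i) (real_of_int a) * poly (r j) (real_of_int a))
        = (\<Sum>k\<le>M. q ^ (k + 1) / (fact k * fact (M - k))
            * (\<Prod>l<i. real k - real l) * (\<Prod>l<j. real (M - k) - real l))"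
      unfolding U sum_interval_shift
      by (intro sum.cong refl) (simp add: w poly_p poly_r of_nat_diff)
    \<comment> \<open>Since \<open>Suc M - (i + 1) = M - i\<close>, the falling factorial left in
      the moment is again a value of \<open>r j\<close>, now at \<open>i + 1\<close>.\<close>
    also have "\<dots> = q ^ (i + 1) * (1 + q) ^ (M - i) / fact (M - i)
          * poly (r j) (real (i + 1)) * (1 / (1 + q) ^ j)"
      unfolding krawtchouk_moment[OF q iM] using iM by (simp add: poly_r of_nat_diff)
    finally show "(case (i, j) of (i, j) \<Rightarrow> \<Sum>a\<in>U. w a * poly (p i) (real_of_int a) * poly (r j) (real_of_int a))
      = (case (i, j) of (i, j) \<Rightarrow> q ^ (i + 1) * (1 + q) ^ (M - i) / fact (M - i)
          * poly (r j) (real (i + 1)) * (1 / (1 + q) ^ j))"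
      by simp
  qed auto
  also have "det \<dots> = (\<Prod>i<m. q ^ (i + 1) * (1 + q) ^ (M - i) / fact (M - i)) * (\<Prod>j<m. 1 / (1 + q) ^ j)
      * det (mat m m (\<lambda>(i, j). poly (r j) (real (i + 1))))"
    by (rule det_scale_rows_columns)
  \<comment> \<open>The Vandermonde evaluation at the nodes \<open>1, ..., m\<close> brings in a
    second \<open>s\<close>, which matches the one on the left because
    \<open>s * s = 1\<close>.\<close>
  also have "det (mat m m (\<lambda>(i, j). poly (r j) (real (i + 1)))) = s * (\<Prod>j<m. \<Prod>i<j. real (j + 1) - real (i + 1))"
    using det_polys_eq_vandermonde[of r m "\<lambda>i. real (i + 1)"] deg by (simp add: lead s_def)
  also have "(\<Prod>j<m. \<Prod>i<j. real (j + 1) - real (i + 1)) = (\<Prod>j<m. fact j)"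
    using prod_falling_nat by simp
  finally have "s * s * (\<Sum>X | X \<subseteq> U \<and> card X = m. (\<Prod>a\<in>X. w a) * (real_of_int (vandermonde X))\<^sup>2)
     = s * s * ((\<Prod>i<m. q ^ (i + 1) * (1 + q) ^ (M - i) / fact (M - i)) * (\<Prod>j<m. 1 / (1 + q) ^ j)
      * (\<Prod>j<m. fact j))"
    by (simp only: mult.assoc mult.left_commute)
  then show ?thesis
    by (simp add: s2 w_def)
qed

section \<open>The generating function in closed form\<close>

lemma barnes_G_Suc: "barnes_G (m + 1) = (\<Prod>j<m. fact j)"
proof -
  \<comment> \<open>The extra factor at \<open>j = 0\<close> is \<open>fact 0 = 1\<close>.\<close>
  have "(\<Prod>j<m. fact j) = (\<Prod>j\<in>{1..<m}. fact j :: nat)"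
    by (rule prod.mono_neutral_right) (auto simp: not_less_eq_eq)
  then show ?thesis
    by (simp add: barnes_G_def)
qed

lemma vandermonde_generating_function:
  fixes q :: real
  assumes "n \<ge> 1" "q > 0" and U: "U = {1..int (m + n)}"
  shows "(\<Sum>X | X \<subseteq> U \<and> card X = m. real_of_int (vandermonde X * vandermonde (U - X)) * q ^ nat (\<Sum>X))
       = real (barnes_G (m + 1) * barnes_G (n + 1)) * q ^ (\<Sum>i<m. i + 1) * (1 + q) ^ (m * n)"
proof -
  define M where "M = m + n - 1"
  have M: "m + n = Suc M" "m \<le> Suc M"
    using assms by (auto simp: M_def)
  define W where "W x = (\<Prod>u\<in>U - {x}. \<bar>u - x\<bar>)" for x
  have Wpos: "W x > 0" for x
    unfolding W_def by (intro prod_pos) auto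
  have fin: "finite U"
    by (simp add: U)
  have "(\<Sum>X | X \<subseteq> U \<and> card X = m. real_of_int (vandermonde X * vandermonde (U - X)) * q ^ nat (\<Sum>X))
     = (\<Sum>X | X \<subseteq> U \<and> card X = m. real_of_int (vandermonde U) *
          ((\<Prod>x\<in>X. q ^ nat x / real_of_int (W x)) * (real_of_int (vandermonde X))\<^sup>2))"
  proof (intro sum.cong refl)
    fix X assume "X \<in> {X. X \<subseteq> U \<and> card X = m}"
    then have X: "X \<subseteq> U"
      by simp
    have "(\<Sum>x\<in>X. int (nat x)) = \<Sum>X"
      using X by (intro sum.cong) (auto simp: U)
    then have "nat (\<Sum>X) = (\<Sum>x\<in>X. nat x)"
      by (metis nat_int of_nat_sum)
    then have q: "q ^ nat (\<Sum>X) = (\<Prod>x\<in>X. q ^ nat x)"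
      by (simp add: power_sum)
    have "real_of_int (vandermonde X * vandermonde (U - X)) * (\<Prod>x\<in>X. real_of_int (W x))
        = real_of_int (vandermonde U) * (real_of_int (vandermonde X))\<^sup>2"
      using arg_cong[OF vandermonde_complement[OF fin X], of real_of_int] by (simp add: W_def)
    moreover have "(\<Prod>x\<in>X. real_of_int (W x)) > 0"
      using Wpos by (intro prod_pos) simp
    ultimately show "real_of_int (vandermonde X * vandermonde (U - X)) * q ^ nat (\<Sum>X)
        = real_of_int (vandermonde U) * ((\<Prod>x\<in>X. q ^ nat x / real_of_int (W x)) * (real_of_int (vandermonde X))\<^sup>2)"
      by (simp add: q prod_dividef field_simps)
  qed
  also have "\<dots> = real_of_int (vandermonde U) * ((\<Prod>i<m. q ^ (i + 1) * (1 + q) ^ (M - i) / fact (M - i))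
      * (\<Prod>i<m. 1 / (1 + q) ^ i) * (\<Prod>i<m. fact i))"
    unfolding W_def sum_distrib_left[symmetric]
    by (subst krawtchouk_ensemble[where M = M]) (use assms M in auto)
  finally have main: "(\<Sum>X | X \<subseteq> U \<and> card X = m. real_of_int (vandermonde X * vandermonde (U - X)) * q ^ nat (\<Sum>X))
     = real_of_int (vandermonde U) * ((\<Prod>i<m. q ^ (i + 1) * (1 + q) ^ (M - i) / fact (M - i))
      * (\<Prod>i<m. 1 / (1 + q) ^ i) * (\<Prod>i<m. fact i))" .
  \<comment> \<open>\<open>F\<close> collects the factorials \<open>k!\<close> with
    \<open>n \<le> k < m + n\<close> in \<open>vandermonde U\<close> and is also the product of the
    row denominators; \<open>D\<close> is shared by the row powers and the column denominators. Both
    cancel at the end.\<close>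
  define F :: real where "F = (\<Prod>i<m. fact (n + i))"
  define D where "D = (\<Prod>i<m. (1 + q) ^ i)"
  have nonzero: "F \<noteq> 0" "D \<noteq> 0"
    using assms(2) by (auto simp: F_def D_def prod_zero_iff)
  have VU: "real_of_int (vandermonde U) = (\<Prod>k<n. fact k) * F"
    unfolding U vandermonde_interval F_def by (induction m) (auto simp: add.commute mult.assoc)
  \<comment> \<open>For \<open>i < m\<close>, \<open>M - i = n + (m - Suc i)\<close>, so reversing
    the index turns the product into \<open>F\<close>; the powers of \<open>1 + q\<close> are
    treated alike.\<close>
  have "(\<Prod>i<m. fact (M - i)) = (\<Prod>i<m. fact (n + (m - Suc i)) :: real)"
    by (intro prod.cong) (auto simp: M_def intro!: arg_cong[of _ _ fact])
  then have facts: "(\<Prod>i<m. fact (M - i)) = F"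
    unfolding F_def prod.nat_diff_reindex[of "\<lambda>i. fact (n + i)"] .
  have "(\<Prod>i<m. (1 + q) ^ (M - i)) = (\<Prod>i<m. (1 + q) ^ (n + (m - Suc i)))"
    by (intro prod.cong) (auto simp: M_def intro!: arg_cong[of _ _ "(^) (1 + q)"])
  then have powers: "(\<Prod>i<m. (1 + q) ^ (M - i)) = (1 + q) ^ (m * n) * D"
    unfolding D_def prod.nat_diff_reindex[of "\<lambda>i. (1 + q) ^ (n + i)"]
    by (simp add: power_add prod.distrib mult.commute flip: power_mult)
  have rows: "(\<Prod>i<m. q ^ (i + 1) * (1 + q) ^ (M - i) / fact (M - i))
     = q ^ (\<Sum>i<m. i + 1) * ((1 + q) ^ (m * n) * D) / F"
    unfolding prod_dividef prod.distrib facts powers by (simp only: power_sum)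
  have columns: "(\<Prod>i<m. 1 / (1 + q) ^ i) = 1 / D"
    by (simp add: D_def prod_dividef)
  have G: "real (barnes_G (m + 1) * barnes_G (n + 1)) = (\<Prod>i<m. fact i) * (\<Prod>k<n. fact k)"
    unfolding barnes_G_Suc by simp
  show ?thesis
    unfolding main VU rows columns G using nonzero by simp
qed

section \<open>Comparison of coefficients\<close>

theorem theorem1:
  fixes m n :: nat and t :: int and U :: "int set"
  assumes "m \<ge> 1" and "n \<ge> 1"
    and "U = {1..int (m + n)}"
    and "int m * (int m + 1) div 2 \<le> t"
    and "t \<le> int m * (int m + 1) div 2 + int m * int n"
  shows "(\<Sum>X | X \<subseteq> U \<and> card X = m \<and> \<Sum>X = t. vandermonde X * vandermonde (U - X))
       = int (barnes_G (m + 1)) * int (barnes_G (n + 1))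
         * int ((m * n) choose nat (t - int m * (int m + 1) div 2))"
proof -
  define e where "e = (\<Sum>i<m. i + 1)"
  define v where "v X = real_of_int (vandermonde X * vandermonde (U - X))" for X
  define c where "c = real (barnes_G (m + 1) * barnes_G (n + 1))"
  let ?S = "{X. X \<subseteq> U \<and> card X = m}"
  \<comment> \<open>\<open>P\<close> and \<open>Q\<close> are the two sides of the generating
    function identity as real polynomials. They agree at every \<open>q > 0\<close>, so
    \<open>P - Q\<close> has infinitely many roots and is zero.\<close>
  define P where "P = (\<Sum>X\<in>?S. monom (v X) (nat (\<Sum>X)))"
  define Q where "Q = smult c (monom 1 e * [:1, 1:] ^ (m * n))"
  have "2 * e = m * (m + 1)"
    unfolding e_def by (induction m) auto
  then have "int (m * (m + 1)) = int (2 * e)"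
    by (simp only:)
  then have "int m * (int m + 1) = 2 * int e"
    by (simp add: algebra_simps)
  then have e: "int m * (int m + 1) div 2 = int e"
    by simp
  have "poly P q = poly Q q" if "q > 0" for q
    using vandermonde_generating_function[OF assms(2) that assms(3)]
    by (simp add: P_def Q_def poly_sum poly_monom v_def c_def e_def)
  then have "{0<..} \<subseteq> {q. poly (P - Q) q = 0}"
    by auto
  then have "infinite {q. poly (P - Q) q = 0}"
    using infinite_Ioi finite_subset by blast
  then have "P = Q"
    using poly_roots_finite[of "P - Q"] by auto
  have fin: "finite ?S"
    using assms(3) by simp
  have "real_of_int (\<Sum>X | X \<subseteq> U \<and> card X = m \<and> \<Sum>X = t. vandermonde X * vandermonde (U - X))
      = (\<Sum>X | X \<subseteq> U \<and> card X = m \<and> \<Sum>X = t. v X)"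
    by (simp add: v_def)
  \<comment> \<open>Exponents are natural numbers; as \<open>t\<close> and all the sums are
    nonnegative, \<open>nat\<close> identifies no two different values here.\<close>
  also have "\<dots> = (\<Sum>X\<in>?S. if nat (\<Sum>X) = nat t then v X else 0)"
  proof (rule sum.mono_neutral_cong_left[OF fin])
    have "nat (\<Sum>X) = nat t \<longleftrightarrow> \<Sum>X = t" if "X \<in> ?S" for X
    proof -
      have "\<Sum>X \<ge> 0"
        using that assms(3) by (intro sum_nonneg) auto
      moreover have "t \<ge> 0"
        using assms(4) e by simp
      ultimately show ?thesis
        by (simp add: eq_nat_nat_iff)
    qed
    then show "\<forall>X\<in>?S - {X. X \<subseteq> U \<and> card X = m \<and> \<Sum>X = t}. (if nat (\<Sum>X) = nat t then v X else 0) = 0"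
      by auto
  qed auto
  also have "\<dots> = coeff P (nat t)"
    by (simp add: P_def coeff_sum)
  \<comment> \<open>The factor \<open>monom 1 e\<close> shifts exponents by \<open>e\<close>; the
    bounds on \<open>t\<close> place \<open>nat t - e\<close> between 0 and \<open>m * n\<close>,
    where the coefficient of \<open>[:1, 1:] ^ (m * n)\<close> is the binomial.\<close>
  also have "\<dots> = c * real ((m * n) choose (nat t - e))"
  proof -
    have "e \<le> nat t" "nat t - e \<le> m * n"
      using assms(4,5) unfolding e by (simp_all add: nat_le_iff le_nat_iff flip: of_nat_mult)
    then show ?thesis
      unfolding \<open>P = Q\<close> by (simp add: Q_def coeff_monom_mult coeff_linear_poly_power)
  qed
  also have "nat t - e = nat (t - int e)"
    using assms(4) e by (simp add: nat_diff_distrib)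
  finally have "real_of_int (\<Sum>X | X \<subseteq> U \<and> card X = m \<and> \<Sum>X = t. vandermonde X * vandermonde (U - X))
      = real_of_int (int (barnes_G (m + 1)) * int (barnes_G (n + 1)) * int ((m * n) choose nat (t - int e)))"
    by (simp add: c_def)
  then show ?thesis
    unfolding e by (simp only: of_int_eq_iff)
qed

end
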